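(* Let $\mathbb{F}$ be a finite field and $d,q$ integers with $0\le q\le d/2$. Consider the Polynomial Evaluation problem: given $q$ quantum queries to a polynomial $A:\mathbb{F}\to\mathbb{F}$ drawn uniformly at random from the polynomials of degree at most $d$, output $q+1$ distinct inputs $y_1,\dots,y_{q+1}\in\mathbb{F}$ (which may be chosen after the queries) together with the values $A(y_1),\dots,A(y_{q+1})$. The maximum success probability of any $q$-query quantum algorithm for this problem is at most $\frac{(q+1)q\,e^{2\sqrt q}}{|\mathbb{F}|}$.
   Context: A quantum query to $A$ is the unitary $|x,y,z\rangle\mapsto|x,y+A(x),z\rangle$ for $x,y\in\mathbb{F}$; queries may be adaptive. Success means all $q+1$ pairs are correct with distinct inputs; probability averaged over the uniformly random $A$.
   Formalization: The case q = 0 is excluded (1 ≤ q ≤ d/2 is assumed): for q = 0 the printed bound is 0, but an algorithm that makes no query and guesses one value succeeds with probability 1/|F| > 0, so the claim is false there. *)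

theory Defs
  imports "HOL-Analysis.Analysis" "HOL-Computational_Algebra.Polynomial"
begin

section \<open>Finite-dimensional complex linear algebra\<close>

definition cinner :: "complex ^ 'n \<Rightarrow> complex ^ 'n \<Rightarrow> complex" where
  "cinner v w = (\<Sum>i\<in>UNIV. cnj (v $ i) * w $ i)"

definition adjoint_mat :: "complex ^ 'n ^ 'n \<Rightarrow> complex ^ 'n ^ 'n" where
  "adjoint_mat M = (\<chi> i j. cnj (M $ j $ i))"

definition unitary_mat :: "complex ^ 'n ^ 'n \<Rightarrow> bool" where
  "unitary_mat U \<longleftrightarrow> adjoint_mat U ** U = mat 1 \<and> U ** adjoint_mat U = mat 1"

definition positive_mat :: "complex ^ 'n ^ 'n \<Rightarrow> bool" where
  "positive_mat E \<longleftrightarrow> adjoint_mat E = E \<and> (\<forall>v. 0 \<le> Re (cinner v (E *v v)))"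


section \<open>Quantum query algorithms\<close>

text \<open>
  The computational basis consists of the \<open>|x,y,z\<rangle>\<close> with query register \<open>x\<close>, response
  register \<open>y\<close>, and a workspace register \<open>z\<close> ranging over an arbitrary finite type.
\<close>

type_synonym ('f, 'z) qstate = "complex ^ ('f \<times> 'f \<times> 'z)"
type_synonym ('f, 'z) qop = "complex ^ ('f \<times> 'f \<times> 'z) ^ ('f \<times> 'f \<times> 'z)"

definition query_op :: "('f::{field,finite}) poly \<Rightarrow> ('f, 'z::finite) qop" where
  "query_op A = (\<chi> i j. case j of (x, y, z) \<Rightarrow> if i = (x, y + poly A x, z) then 1 else 0)"

lemma query_op_axis:
  "query_op A *v axis (x, y, z) 1 = axis (x, y + poly A x, z) 1"
  by (simp add: query_op_def vec_eq_iff matrix_vector_mul_component inner_axis axis_def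
      matrix_vector_mult_def if_distrib cong: if_cong)

text \<open>
  An algorithm alternates queries with input-independent unitaries and ends with a general
  measurement (POVM), whose outcome is the list of pairs \<open>(y\<^sub>i, v\<^sub>i)\<close> it outputs. Adaptivity is
  captured by the unitaries, and intermediate measurements can be deferred because the
  workspace is arbitrary. A run that gives up is modelled by an incorrect output.
\<close>

record ('f, 'z) qalg =
  init :: "('f, 'z) qstate"
  gate :: "nat \<Rightarrow> ('f, 'z) qop"
  meas :: "('f \<times> 'f) list \<Rightarrow> ('f, 'z) qop"

text \<open>\<open>gate alg k\<close> is applied after query number \<open>k + 1\<close>.\<close>

definition query_algorithm :: "nat \<Rightarrow> ('f::{field,finite}, 'z::finite) qalg \<Rightarrow> bool" where
  "query_algorithm q alg \<longleftrightarrow>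
     norm (init alg) = 1 \<and>
     (\<forall>k<q. unitary_mat (gate alg k)) \<and>
     (\<forall>out. length out = q + 1 \<longrightarrow> positive_mat (meas alg out)) \<and>
     (\<Sum>out | length out = q + 1. meas alg out) = mat 1"

primrec run :: "('f::{field,finite}, 'z::finite) qalg \<Rightarrow> 'f poly \<Rightarrow> nat \<Rightarrow> ('f, 'z) qstate" where
  "run alg A 0 = init alg"
| "run alg A (Suc k) = gate alg k *v (query_op A *v run alg A k)"

text \<open>The Born rule: the probability that the measurement after \<open>q\<close> queries yields \<open>out\<close>.\<close>

definition output_prob ::
  "nat \<Rightarrow> ('f::{field,finite}, 'z::finite) qalg \<Rightarrow> 'f poly \<Rightarrow> ('f \<times> 'f) list \<Rightarrow> real" where
  "output_prob q alg A out = Re (cinner (run alg A q) (meas alg out *v run alg A q))"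


section \<open>Polynomial evaluation\<close>

definition polys_upto :: "nat \<Rightarrow> ('f::field) poly set" where
  "polys_upto d = {A. degree A \<le> d}"

definition correct_outputs :: "nat \<Rightarrow> ('f::field) poly \<Rightarrow> ('f \<times> 'f) list set" where
  "correct_outputs q A =
     {out. length out = q + 1 \<and> distinct (map fst out) \<and> (\<forall>(y, v)\<in>set out. v = poly A y)}"

definition success_prob :: "nat \<Rightarrow> nat \<Rightarrow> ('f::{field,finite}, 'z::finite) qalg \<Rightarrow> real" where
  "success_prob d q alg =
     (\<Sum>A\<in>polys_upto d. \<Sum>out\<in>correct_outputs q A. output_prob q alg A out)
       / real (card (polys_upto d :: 'f poly set))"

lemma finite_polys_upto: "finite (polys_upto d :: ('f::{field,finite}) poly set)"
proof (rule finite_subset)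
  show "polys_upto d \<subseteq> Poly ` {xs :: 'f list. set xs \<subseteq> UNIV \<and> length xs \<le> d + 1}"
  proof
    fix A :: "'f poly" assume "A \<in> polys_upto d"
    then have "length (coeffs A) \<le> d + 1"
      by (cases "A = 0") (auto simp: polys_upto_def length_coeffs_degree)
    then show "A \<in> Poly ` {xs. set xs \<subseteq> UNIV \<and> length xs \<le> d + 1}"
      by (intro image_eqI[of _ _ "coeffs A"]) auto
  qed
  show "finite (Poly ` {xs :: 'f list. set xs \<subseteq> UNIV \<and> length xs \<le> d + 1})"
    by (intro finite_imageI finite_lists_length_le) simp
qed

lemma finite_correct_outputs: "finite (correct_outputs q (A :: ('f::{field,finite}) poly))"
  by (rule finite_subset[OF _ finite_lists_length_eq[of UNIV "q + 1"]])
     (auto simp: correct_outputs_def)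

text \<open>
  With no query at all one can still guess a value, so a bound with a factor \<open>q\<close> can only
  hold for \<open>q \<ge> 1\<close>.
\<close>

lemma zero_queries_success_prob_pos:
  "\<exists>alg :: ('f::{field,finite}, 'z::finite) qalg. query_algorithm 0 alg \<and> success_prob d 0 alg > 0"
proof -
  define ini :: "('f, 'z) qstate" where "ini = axis undefined 1"
  define alg :: "('f, 'z) qalg" where
    "alg = \<lparr>init = ini, gate = (\<lambda>_. mat 1), meas = (\<lambda>out. if out = [(0, 0)] then mat 1 else 0)\<rparr>"
  have cinner_self: "0 \<le> Re (cinner v v)" for v :: "('f, 'z) qstate"
    by (auto simp: cinner_def intro!: sum_nonneg)
  have cinner_0: "cinner v 0 = 0" for v :: "('f, 'z) qstate"
    by (simp add: cinner_def)
  have cinner_ini: "cinner ini ini = 1"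
    by (simp add: ini_def cinner_def axis_def if_distrib cong: if_cong)
  have fin: "finite {out :: ('f \<times> 'f) list. length out = 1}"
    using finite_lists_length_eq[of "UNIV :: ('f \<times> 'f) set" 1] by simp
  have sum1: "(\<Sum>out | length out = 1. meas alg out) = mat 1"
    using fin by (simp add: alg_def sum.delta)
  have adj: "adjoint_mat (mat 1 :: ('f, 'z) qop) = mat 1" "adjoint_mat (0 :: ('f, 'z) qop) = 0"
    by (auto simp: adjoint_mat_def mat_def vec_eq_iff)
  have pos: "positive_mat (meas alg out)" for out
    using adj cinner_self cinner_0 by (simp add: positive_mat_def alg_def)
  have valid: "query_algorithm 0 alg"
    using pos sum1 by (simp add: query_algorithm_def) (simp add: alg_def ini_def)
  have out: "output_prob 0 alg A out = (if out = [(0, 0)] then 1 else 0)" for A out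
    using cinner_ini cinner_0 by (auto simp: output_prob_def alg_def)
  have "0 < (\<Sum>A\<in>polys_upto d. \<Sum>out\<in>correct_outputs 0 A. output_prob 0 alg A out)"
  proof (rule sum_pos2[OF finite_polys_upto, of 0])
    show "0 \<in> polys_upto d" by (simp add: polys_upto_def)
    have "[(0, 0)] \<in> correct_outputs 0 (0 :: 'f poly)" by (simp add: correct_outputs_def)
    then show "0 < (\<Sum>out\<in>correct_outputs 0 0. output_prob 0 alg 0 out)"
      unfolding out using finite_correct_outputs[of 0 "0 :: 'f poly"] by (simp add: sum.delta)
  qed (auto simp: out intro!: sum_nonneg)
  moreover have "card (polys_upto d :: 'f poly set) > 0"
    using finite_polys_upto[of d] by (auto simp: card_gt_0_iff polys_upto_def intro: exI[of _ 0])
  ultimately show ?thesis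
    using valid by (intro exI[of _ alg]) (simp add: success_prob_def)
qed

end

theory Submission
  imports Defs
begin

text \<open>
  Expand the state after \<open>q\<close> queries, as a function of the polynomial \<open>A\<close>, in the characters
  \<open>\<xi> (\<Sum>x. c x * A x)\<close> of the group of polynomials of degree at most \<open>d\<close>: only coefficient
  functions \<open>c\<close> with at most \<open>q\<close> nonzero values occur, and since \<open>2 * q \<le> d\<close> these give
  distinct, hence orthogonal, characters. For a fixed output with inputs \<open>Y\<close> the correct
  polynomials form a coset of the group of polynomials vanishing on \<open>Y\<close>, which has index at least
  \<open>N ^ (q + 1)\<close> for \<open>N = CARD('f)\<close>. Summed over this coset, two characters interact only
  if they agree on that group, so the probability of the output being correct exceeds the index
  fraction at most by a factor equal to the largest number of admissible \<open>c\<close> in one such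
  class. Lagrange interpolation bounds this number by \<open>2 * exp 1 * (q + 1) * N ^ q\<close>.
\<close>

section \<open>Additive characters of finite fields\<close>

locale additive_character =
  fixes \<xi> :: "'f::{field,finite} \<Rightarrow> complex"
  assumes char_add: "\<xi> (a + b) = \<xi> a * \<xi> b"
    and norm_char: "norm (\<xi> a) = 1"
    and nontrivial: "\<exists>a. \<xi> a \<noteq> 1"

text \<open>
  A maximal proper additive subgroup \<open>H\<close> has prime index, so the character is obtained by sending
  the coset of a generator \<open>g\<close> of the quotient to a primitive root of unity.
\<close>

lemma additive_character_exists:
  "\<exists>\<xi> :: 'f::{field,finite} \<Rightarrow> complex. additive_character \<xi>"
proof -
  define sg :: "'f set \<Rightarrow> bool" where
    "sg H \<longleftrightarrow> 0 \<in> H \<and> (\<forall>a\<in>H. \<forall>b\<in>H. a - b \<in> H)" for H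
  have sg_diff: "a - b \<in> H" if "sg H" "a \<in> H" "b \<in> H" for H a b
    using that by (simp add: sg_def)
  have sg_zero: "0 \<in> H" if "sg H" for H
    using that by (simp add: sg_def)
  have sg_add: "a + b \<in> H" if "sg H" "a \<in> H" "b \<in> H" for H a b
    using sg_diff[OF that(1) that(2) sg_diff[OF that(1) sg_zero[OF that(1)] that(3)]] by simp
  have sg_nat: "of_nat n * a \<in> H" if "sg H" "a \<in> H" for H a n
    using that by (induction n) (auto simp: algebra_simps sg_zero sg_add)
  have "(1 :: 'f) \<notin> {0}" by simp
  then have "{0} \<noteq> (UNIV :: 'f set)" by blast
  moreover have "sg {0}" by (simp add: sg_def)
  ultimately have "{H. sg H \<and> H \<noteq> UNIV} \<noteq> {}" by blast
  from finite_has_maximal[OF _ this] obtain H where H: "sg H" "H \<noteq> UNIV"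
    and maximal: "\<And>K. sg K \<Longrightarrow> H \<subset> K \<Longrightarrow> K = UNIV"
    by (auto simp: psubset_eq)
  then obtain g where g: "g \<notin> H" by auto
  define p where "p = CHAR('f)"
  have p: "prime p" "of_nat p = (0 :: 'f)"
    using prime_CHAR_semidom[OF finite_imp_CHAR_pos[OF finite]] of_nat_CHAR
    by (simp_all add: p_def)
  \<comment> \<open>\<open>K\<close> is the subgroup generated by \<open>H\<close> and
    \<open>g\<close>. Natural multiples of \<open>g\<close> suffice because the characteristic is
    positive, so negatives are multiples too.\<close>
  define K where "K = {a. \<exists>k. a - of_nat k * g \<in> H}"
  have neg: "\<exists>l. of_nat l = - (of_nat k :: 'f)" for k
  proof (intro exI)
    have "of_nat (p * k) = (0 :: 'f)" using p by simp
    moreover have "p * k = k + (p - 1) * k"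
      using prime_gt_0_nat[OF p(1)] by (cases p) auto
    ultimately show "of_nat ((p - 1) * k) = - (of_nat k :: 'f)"
      by (metis add.inverse_unique of_nat_add)
  qed
  have "sg K"
    unfolding sg_def
  proof (intro conjI ballI)
    show "0 \<in> K" using sg_zero[OF H(1)] by (auto simp: K_def intro!: exI[of _ 0])
    fix a b assume "a \<in> K" "b \<in> K"
    then obtain k l where kl: "a - of_nat k * g \<in> H" "b - of_nat l * g \<in> H"
      by (auto simp: K_def)
    obtain m where m: "of_nat m = - (of_nat l :: 'f)" using neg by blast
    have "(a - b) - of_nat (k + m) * g = (a - of_nat k * g) - (b - of_nat l * g)"
      by (simp add: m algebra_simps)
    then have "(a - b) - of_nat (k + m) * g \<in> H"
      using sg_diff[OF H(1) kl] by (simp only:)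
    then show "a - b \<in> K" unfolding K_def by blast
  qed
  moreover have "H \<subseteq> K" by (auto simp: K_def intro!: exI[of _ 0])
  moreover have "g \<in> K" using sg_zero[OF H(1)] by (auto simp: K_def intro!: exI[of _ 1])
  ultimately have "K = UNIV" using maximal g by blast
  then have ex: "\<exists>k. a - of_nat k * g \<in> H" for a by (auto simp: K_def)
  \<comment> \<open>The index of the coset of \<open>a\<close> in the quotient, an arbitrary
    representative that is determined only modulo \<open>p\<close>.\<close>
  define ind where "ind a = (SOME k. a - of_nat k * g \<in> H)" for a
  have ind: "a - of_nat (ind a) * g \<in> H" for a
    unfolding ind_def by (rule someI_ex[OF ex])
  \<comment> \<open>Otherwise \<open>m = l - k\<close> is invertible modulo \<open>p\<close>, and
    multiplying \<open>m * g\<close> by its inverse would put \<open>g\<close> itself into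
    \<open>H\<close>.\<close>
  have wd_le: "k mod p = l mod p" if "k \<le> l" "(of_nat k - of_nat l) * g \<in> H" for k l
  proof (rule ccontr)
    assume neq: "k mod p \<noteq> l mod p"
    define m where "m = l - k"
    have "\<not> p dvd m"
      using neq mod_eq_dvd_iff_nat[OF that(1), of p] by (auto simp: m_def)
    then have "m \<noteq> 0" by (metis dvd_0_right)
    moreover have "gcd m p = 1"
      using prime_imp_coprime[OF p(1) \<open>\<not> p dvd m\<close>] by (simp add: gcd.commute coprime_iff_gcd_eq_1)
    ultimately obtain u v where uv: "m * u = p * v + 1"
      using bezout_nat[of m p] by auto
    have "0 - (of_nat k - of_nat l) * g = of_nat m * g"
      using that(1) by (simp add: m_def of_nat_diff algebra_simps)
    then have "of_nat m * g \<in> H" using sg_diff[OF H(1) sg_zero[OF H(1)] that(2)] by simp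
    then have "of_nat u * (of_nat m * g) \<in> H" by (rule sg_nat[OF H(1)])
    moreover have "of_nat u * (of_nat m * g) = of_nat (m * u) * g"
      by (simp add: mult_ac)
    moreover have "of_nat (m * u) = (1 :: 'f)"
      by (simp add: uv p(2) del: of_nat_mult) (simp add: p(2))
    ultimately show False using g by simp
  qed
  have wd: "k mod p = l mod p" if "(of_nat k - of_nat l) * g \<in> H" for k l
  proof (cases "k \<le> l")
    case False
    have "0 - (of_nat k - of_nat l) * g \<in> H"
      by (rule sg_diff[OF H(1) sg_zero[OF H(1)] that])
    then show ?thesis using False wd_le[of l k] by (simp add: algebra_simps)
  qed (use wd_le that in auto)
  define \<omega> where "\<omega> = cis (2 * pi / real p)"
  have p1: "p > 1" using p(1) prime_gt_1_nat by auto
  have "\<omega> ^ p = 1"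
    using p1 by (simp add: \<omega>_def Complex.DeMoivre)
  then have "\<omega> ^ (p * (k div p) + k mod p) = \<omega> ^ (k mod p)" for k
    by (simp only: power_add power_mult power_one mult_1_left)
  then have \<omega>_mod: "\<omega> ^ (k mod p) = \<omega> ^ k" for k
    by (metis mult_div_mod_eq)
  have "\<omega> \<noteq> 1"
  proof
    assume "\<omega> = 1"
    then have "cos (2 * pi / real p) = 1" by (simp add: \<omega>_def complex_eq_iff)
    then obtain x :: int where "2 * pi / real p = real_of_int x * 2 * pi"
      using cos_one_2pi_int by blast
    then have "real_of_int (x * int p) = real_of_int 1" using p1 by (simp add: field_simps)
    then have "x * int p = 1" by (simp only: of_int_eq_iff)
    then show False using p1 by (simp add: zmult_eq_1_iff)
  qed
  have "additive_character (\<lambda>a. \<omega> ^ ind a)"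
  proof
    fix a b
    have "(a + b - of_nat (ind (a + b)) * g)
        - ((a - of_nat (ind a) * g) + (b - of_nat (ind b) * g)) \<in> H"
      by (intro sg_diff sg_add H ind)
    also have "(a + b - of_nat (ind (a + b)) * g)
        - ((a - of_nat (ind a) * g) + (b - of_nat (ind b) * g))
      = (of_nat (ind a + ind b) - of_nat (ind (a + b))) * g"
      by (simp add: algebra_simps)
    finally have "(ind a + ind b) mod p = ind (a + b) mod p" by (rule wd)
    then have "\<omega> ^ (ind a + ind b) = \<omega> ^ ind (a + b)"
      using \<omega>_mod[of "ind a + ind b"] \<omega>_mod[of "ind (a + b)"] by simp
    then show "\<omega> ^ ind (a + b) = \<omega> ^ ind a * \<omega> ^ ind b"
      by (simp add: power_add)
    show "norm (\<omega> ^ ind a) = 1" by (simp add: \<omega>_def norm_power)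
    \<comment> \<open>The index of \<open>g\<close> is 1 modulo \<open>p\<close>, so the character
      takes the value \<open>\<omega>\<close> at \<open>g\<close>.\<close>
    have "(of_nat (ind g) - of_nat 1) * g = 0 - (g - of_nat (ind g) * g)"
      by (simp add: algebra_simps)
    then have "ind g mod p = 1 mod p"
      using sg_diff[OF H(1) sg_zero[OF H(1)] ind[of g]] by (intro wd) simp
    then show "\<exists>a. \<omega> ^ ind a \<noteq> 1"
      using \<omega>_mod[of "ind g"] \<omega>_mod[of 1] \<open>\<omega> \<noteq> 1\<close> by (intro exI[of _ g]) simp
  qed
  then show ?thesis by blast
qed

section \<open>Evaluation functionals on polynomials\<close>

definition supp :: "('f \<Rightarrow> 'f::zero) \<Rightarrow> 'f set" where
  "supp c = {x. c x \<noteq> 0}"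

text \<open>A coefficient function \<open>c\<close> stands for a linear combination of point
  evaluations. Composed with \<open>\<xi>\<close> it becomes a character of the additive group of
  polynomials.\<close>

definition pairing :: "('f::{field,finite} \<Rightarrow> 'f) \<Rightarrow> 'f poly \<Rightarrow> 'f" where
  "pairing c A = (\<Sum>x\<in>UNIV. c x * poly A x)"

definition vanishing_polys :: "nat \<Rightarrow> 'f::field set \<Rightarrow> 'f poly set" where
  "vanishing_polys d Y = {A \<in> polys_upto d. \<forall>y\<in>Y. poly A y = 0}"

text \<open>Since the vanishing polynomials are closed under scaling, this says that the character
  attached to \<open>c\<close> is trivial on them.\<close>

definition annihilates :: "nat \<Rightarrow> 'f::{field,finite} set \<Rightarrow> ('f \<Rightarrow> 'f) \<Rightarrow> bool" where
  "annihilates d Y c \<longleftrightarrow> (\<forall>B\<in>vanishing_polys d Y. pairing c B = 0)"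

lemma finite_vanishing_polys: "finite (vanishing_polys d Y :: ('f::{field,finite}) poly set)"
  by (rule finite_subset[OF _ finite_polys_upto[of d]]) (auto simp: vanishing_polys_def)

lemma vanishing_polys_empty: "vanishing_polys d {} = polys_upto d"
  by (simp add: vanishing_polys_def)

lemma add_in_vanishing_polys:
  "A \<in> vanishing_polys d Y \<Longrightarrow> B \<in> vanishing_polys d Y \<Longrightarrow> A + B \<in> vanishing_polys d Y"
  by (auto simp: vanishing_polys_def polys_upto_def intro: degree_add_le)

lemma diff_in_vanishing_polys:
  "A \<in> vanishing_polys d Y \<Longrightarrow> B \<in> vanishing_polys d Y \<Longrightarrow> A - B \<in> vanishing_polys d Y"
  by (auto simp: vanishing_polys_def polys_upto_def intro: degree_diff_le)

lemma smult_in_vanishing_polys: "A \<in> vanishing_polys d Y \<Longrightarrow> smult t A \<in> vanishing_polys d Y"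
  by (auto simp: vanishing_polys_def polys_upto_def intro: order.trans[OF degree_smult_le])

lemma pairing_add_right: "pairing c (A + B) = pairing c A + pairing c B"
  by (simp add: pairing_def algebra_simps sum.distrib)

lemma pairing_add_left: "pairing (\<lambda>x. c x + c' x) A = pairing c A + pairing c' A"
  by (simp add: pairing_def algebra_simps sum.distrib)

lemma pairing_diff_left: "pairing (\<lambda>x. c x - c' x) A = pairing c A - pairing c' A"
  by (simp add: pairing_def algebra_simps sum_subtractf)

lemma pairing_smult: "pairing c (smult t A) = t * pairing c A"
  by (simp add: pairing_def sum_distrib_left mult_ac)

lemma vanishing_poly_nonzero_at:
  fixes Z :: "'f::field set"
  assumes "finite Z" "x \<notin> Z" "card Z \<le> d"
  obtains A where "A \<in> vanishing_polys d Z" "poly A x \<noteq> 0"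
proof
  define A where "A = (\<Prod>z\<in>Z. [:- z, 1:])"
  have "degree A \<le> card Z"
    using degree_prod_sum_le[OF assms(1), of "\<lambda>z. [:- z, 1:]"] by (simp add: A_def o_def)
  then show "A \<in> vanishing_polys d Z"
    using assms(1,3) by (auto simp: A_def vanishing_polys_def polys_upto_def poly_prod)
  show "poly A x \<noteq> 0"
    using assms(1,2) by (auto simp: A_def poly_prod)
qed

text \<open>If \<open>c\<close> were nonzero at some \<open>x\<close> outside \<open>Y\<close>, a
  polynomial vanishing on all other points of \<open>supp c \<union> Y\<close> but not at
  \<open>x\<close> would isolate the term \<open>c x\<close>. At most \<open>d\<close> roots are
  prescribed, so it has admissible degree.\<close>

lemma annihilates_supp:
  fixes c :: "'f::{field,finite} \<Rightarrow> 'f"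
  assumes "annihilates d Y c" "card (supp c \<union> Y) \<le> d + 1"
  shows "supp c \<subseteq> Y"
proof (rule ccontr)
  assume "\<not> supp c \<subseteq> Y"
  then obtain x where x: "x \<in> supp c" "x \<notin> Y" by auto
  define Z where "Z = (supp c \<union> Y) - {x}"
  have "card Z \<le> d" using x assms(2) by (simp add: Z_def)
  then obtain A where A: "A \<in> vanishing_polys d Z" "poly A x \<noteq> 0"
    using vanishing_poly_nonzero_at[of Z x d] by (auto simp: Z_def)
  have "A \<in> vanishing_polys d Y"
    using A(1) x(2) by (auto simp: vanishing_polys_def Z_def)
  moreover have "c z * poly A z = (if z = x then c x * poly A x else 0)" for z
    using A(1) by (auto simp: vanishing_polys_def Z_def supp_def)
  then have "pairing c A = (\<Sum>z\<in>UNIV. if z = x then c x * poly A x else 0)"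
    unfolding pairing_def by (intro sum.cong refl)
  then have "pairing c A = c x * poly A x" by simp
  ultimately show False
    using assms(1) A(2) x(1) by (auto simp: annihilates_def supp_def)
qed

text \<open>When a point \<open>y\<close> joins \<open>Y\<close>, take a polynomial of the larger
  group that is nonzero at \<open>y\<close>. The translates of the smaller group by its scalar
  multiples are disjoint, one for each field element.\<close>

lemma card_vanishing_polys:
  fixes Y :: "'f::{field,finite} set"
  assumes "card Y \<le> d + 1"
  shows "card (vanishing_polys d Y) * CARD('f) ^ card Y \<le> card (polys_upto d :: 'f poly set)"
proof -
  have "finite Y" by simp
  then show ?thesis using assms
  proof (induction Y rule: finite_induct)
    case empty
    show ?case by (simp add: vanishing_polys_empty)
  next
    case (insert y Y)
    obtain A where A: "A \<in> vanishing_polys d Y" "poly A y \<noteq> 0"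
      using vanishing_poly_nonzero_at[of Y y d] insert by auto
    define f where "f = (\<lambda>(B, t). B + smult t A)"
    have "inj_on f (vanishing_polys d (insert y Y) \<times> UNIV)"
    proof (rule inj_onI; clarify)
      fix B B' and s t
      assume B: "B \<in> vanishing_polys d (insert y Y)" "B' \<in> vanishing_polys d (insert y Y)"
        and eq: "f (B, s) = f (B', t)"
      from eq have "poly (B + smult s A) y = poly (B' + smult t A) y" by (simp add: f_def)
      then have "s = t" using B A(2) by (simp add: vanishing_polys_def)
      then show "B = B' \<and> s = t" using eq by (simp add: f_def)
    qed
    moreover have "f ` (vanishing_polys d (insert y Y) \<times> UNIV) \<subseteq> vanishing_polys d Y"
    proof (clarsimp simp: f_def)
      fix B t assume "B \<in> vanishing_polys d (insert y Y)"
      then have "B \<in> vanishing_polys d Y" by (simp add: vanishing_polys_def)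
      then show "B + smult t A \<in> vanishing_polys d Y"
        using A(1) by (intro add_in_vanishing_polys smult_in_vanishing_polys)
    qed
    ultimately have "card (vanishing_polys d (insert y Y) \<times> (UNIV :: 'f set))
        \<le> card (vanishing_polys d Y)"
      using card_inj_on_le finite_vanishing_polys by blast
    then have "card (vanishing_polys d (insert y Y)) * CARD('f) * CARD('f) ^ card Y
        \<le> card (vanishing_polys d Y) * CARD('f) ^ card Y"
      by (intro mult_right_mono) (simp_all add: card_cartesian_product)
    also have "\<dots> \<le> card (polys_upto d :: 'f poly set)"
      using insert by simp
    finally show ?case using insert by (simp add: mult_ac)
  qed
qed

section \<open>Orthogonality of characters on the field and on groups of polynomials\<close>

context additive_character
begin

lemma char_zero: "\<xi> 0 = 1"
  using char_add[of 0 0] norm_char[of 0] by auto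

lemma char_uminus: "\<xi> (- a) = cnj (\<xi> a)"
proof -
  have "\<xi> a * \<xi> (- a) = \<xi> a * cnj (\<xi> a)"
    using char_add[of a "- a"] char_zero norm_char[of a] by (simp add: complex_norm_square[symmetric])
  moreover have "\<xi> a \<noteq> 0" using norm_char[of a] by auto
  ultimately show ?thesis by simp
qed

lemma char_diff: "\<xi> (a - b) = \<xi> a * cnj (\<xi> b)"
  using char_add[of a "- b"] by (simp add: char_uminus)

text \<open>For nonzero \<open>b\<close>, shifting the summation variable by \<open>a / b\<close>
  multiplies the sum by \<open>\<xi> a\<close>, which differs from 1, so the sum vanishes.\<close>

lemma sum_char_mult: "(\<Sum>k\<in>UNIV. \<xi> (k * b)) = (if b = 0 then of_nat CARD('f) else 0)"
proof (cases "b = 0")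
  case False
  obtain a where a: "\<xi> a \<noteq> 1" using nontrivial by blast
  have "(\<Sum>k\<in>UNIV. \<xi> (k * b)) = (\<Sum>k\<in>UNIV. \<xi> ((k + a / b) * b))"
    by (rule sum.reindex_bij_witness[of _ "\<lambda>k. k + a / b" "\<lambda>k. k - a / b"]) auto
  also have "\<dots> = \<xi> a * (\<Sum>k\<in>UNIV. \<xi> (k * b))"
    using False by (simp add: ring_distribs char_add sum_distrib_left mult_ac)
  finally show ?thesis using a False by simp
qed (simp add: char_zero)

text \<open>The same shift argument: a polynomial on which the functional is nonzero is rescaled
  until its value is an \<open>a\<close> with \<open>\<xi> a \<noteq> 1\<close>.\<close>

lemma sum_char_pairing:
  "(\<Sum>A\<in>vanishing_polys d Y. \<xi> (pairing e A))
     = (if annihilates d Y e then of_nat (card (vanishing_polys d Y)) else 0)"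
proof (cases "annihilates d Y e")
  case False
  then obtain B where B: "B \<in> vanishing_polys d Y" "pairing e B \<noteq> 0"
    by (auto simp: annihilates_def)
  obtain a where a: "\<xi> a \<noteq> 1" using nontrivial by blast
  define C where "C = smult (a / pairing e B) B"
  have C: "C \<in> vanishing_polys d Y" "pairing e C = a"
    using B by (auto simp: C_def pairing_smult smult_in_vanishing_polys)
  have "(\<Sum>A\<in>vanishing_polys d Y. \<xi> (pairing e A))
      = (\<Sum>A\<in>vanishing_polys d Y. \<xi> (pairing e (A + C)))"
    by (rule sum.reindex_bij_witness[of _ "\<lambda>A. A + C" "\<lambda>A. A - C"])
       (auto simp: C add_in_vanishing_polys diff_in_vanishing_polys)
  also have "\<dots> = \<xi> a * (\<Sum>A\<in>vanishing_polys d Y. \<xi> (pairing e A))"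
    by (simp add: pairing_add_right C char_add sum_distrib_left mult_ac)
  finally show ?thesis using a False by simp
qed (simp add: annihilates_def char_zero)

text \<open>The fibre is the coset of \<open>vanishing_polys d Y\<close> through
  \<open>A\<^sub>0\<close>, so only the phase at \<open>A\<^sub>0\<close> is added.\<close>

lemma sum_char_fibre:
  assumes "A\<^sub>0 \<in> polys_upto d"
  shows "(\<Sum>A | A \<in> polys_upto d \<and> (\<forall>y\<in>Y. poly A y = poly A\<^sub>0 y). \<xi> (pairing e A))
    = (if annihilates d Y e then of_nat (card (vanishing_polys d Y)) * \<xi> (pairing e A\<^sub>0) else 0)"
proof -
  have A0: "A\<^sub>0 \<in> vanishing_polys d {}" using assms by (simp add: vanishing_polys_empty)
  have "(\<Sum>A | A \<in> polys_upto d \<and> (\<forall>y\<in>Y. poly A y = poly A\<^sub>0 y). \<xi> (pairing e A))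
      = (\<Sum>A\<in>vanishing_polys d Y. \<xi> (pairing e (A\<^sub>0 + A)))"
    using assms
    by (intro sum.reindex_bij_witness[of _ "\<lambda>A. A\<^sub>0 + A" "\<lambda>A. A - A\<^sub>0"])
       (auto simp: vanishing_polys_def polys_upto_def intro: degree_add_le degree_diff_le)
  then show ?thesis
    by (simp add: pairing_add_right char_add sum_char_pairing flip: sum_distrib_left)
qed

end

section \<open>Counting functionals of bounded weight in a class\<close>

definition weight_le :: "nat \<Rightarrow> ('f::{field,finite} \<Rightarrow> 'f) set" where
  "weight_le k = {c. card (supp c) \<le> k}"

lemma supp_diff: "supp (\<lambda>x. c x - c' x) \<subseteq> supp c \<union> supp (c' :: 'f \<Rightarrow> 'f::field)"
  by (auto simp: supp_def)

lemma annihilates_diff: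
  "annihilates d Y c \<Longrightarrow> annihilates d Y c' \<Longrightarrow> annihilates d Y (\<lambda>x. c x - c' x)"
  by (simp add: annihilates_def pairing_diff_left)

lemma annihilates_commute: "annihilates d Y (\<lambda>x. c x - c' x) \<longleftrightarrow> annihilates d Y (\<lambda>x. c' x - c x)"
  by (auto simp: annihilates_def pairing_diff_left)

lemma card_supp_subset:
  "card {g :: 'f::{field,finite} \<Rightarrow> 'f. supp g \<subseteq> T} \<le> CARD('f) ^ card T"
proof -
  have "inj_on (\<lambda>g. restrict g T) {g :: 'f \<Rightarrow> 'f. supp g \<subseteq> T}"
  proof (rule inj_onI, rule ext)
    fix g h :: "'f \<Rightarrow> 'f" and x
    assume "g \<in> {g. supp g \<subseteq> T}" "h \<in> {g. supp g \<subseteq> T}" and eq: "restrict g T = restrict h T"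
    then have "x \<notin> T \<Longrightarrow> g x = 0 \<and> h x = 0" by (auto simp: supp_def)
    then show "g x = h x" using fun_cong[OF eq, of x] by (cases "x \<in> T") auto
  qed
  then have "card {g :: 'f \<Rightarrow> 'f. supp g \<subseteq> T} \<le> card (T \<rightarrow>\<^sub>E (UNIV :: 'f set))"
    by (rule card_inj_on_le) (auto intro: finite_PiE)
  then show ?thesis by (simp add: card_PiE)
qed

lemma card_supp_subset_weight:
  fixes Y :: "'f::{field,finite} set"
  assumes "j \<le> card Y"
  shows "card {g :: 'f \<Rightarrow> 'f. supp g \<subseteq> Y \<and> card (supp g) \<le> j} \<le> (card Y choose j) * CARD('f) ^ j"
proof -
  define \<T> where "\<T> = {T. T \<subseteq> Y \<and> card T = j}"
  have "{g :: 'f \<Rightarrow> 'f. supp g \<subseteq> Y \<and> card (supp g) \<le> j} \<subseteq> (\<Union>T\<in>\<T>. {g. supp g \<subseteq> T})"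
  proof clarify
    fix g :: "'f \<Rightarrow> 'f" assume "supp g \<subseteq> Y" "card (supp g) \<le> j"
    then obtain T where "supp g \<subseteq> T" "T \<subseteq> Y" "card T = j"
      using exists_subset_between[of "supp g" j Y] assms by auto
    then show "g \<in> (\<Union>T\<in>\<T>. {g. supp g \<subseteq> T})" by (auto simp: \<T>_def)
  qed
  then have "card {g :: 'f \<Rightarrow> 'f. supp g \<subseteq> Y \<and> card (supp g) \<le> j}
      \<le> card (\<Union>T\<in>\<T>. {g :: 'f \<Rightarrow> 'f. supp g \<subseteq> T})"
    by (intro card_mono) auto
  also have "\<dots> \<le> (\<Sum>T\<in>\<T>. card {g :: 'f \<Rightarrow> 'f. supp g \<subseteq> T})"
    by (intro card_UN_le) auto
  also have "\<dots> \<le> (\<Sum>T\<in>\<T>. CARD('f) ^ j)"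
  proof (rule sum_mono)
    fix T assume "T \<in> \<T>"
    then show "card {g :: 'f \<Rightarrow> 'f. supp g \<subseteq> T} \<le> CARD('f) ^ j"
      using card_supp_subset[of T] by (simp add: \<T>_def)
  qed
  also have "\<dots> = (card Y choose j) * CARD('f) ^ j"
    by (simp add: \<T>_def n_subsets)
  finally show ?thesis .
qed

text \<open>
  Two elements with the same part on \<open>Y\<close> whose parts off \<open>Y\<close> share \<open>2 * w - q\<close> points differ
  in at most \<open>q\<close> points off \<open>Y\<close>, so interpolation forces them to be equal. The truncated
  subtraction makes this cover \<open>2 * w < q\<close> as well.
\<close>

lemma card_annihilating_class_weight:
  fixes Y :: "'f::{field,finite} set"
  assumes Y: "card Y = q + 1" and d: "2 * q \<le> d" and w: "w \<le> q"
    and S: "\<And>c c'. c \<in> S \<Longrightarrow> c' \<in> S \<Longrightarrow> annihilates d Y (\<lambda>x. c x - c' x)"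
    and wt: "\<And>c. c \<in> S \<Longrightarrow> card (supp c) \<le> q \<and> card (supp c - Y) = w"
  shows "card S \<le> ((q + 1) choose (q - w)) * CARD('f) ^ (q - w) * CARD('f) ^ (2 * w - q)"
proof -
  define G where "G = {g :: 'f \<Rightarrow> 'f. supp g \<subseteq> Y \<and> card (supp g) \<le> q - w}"
  \<comment> \<open>An arbitrary choice of \<open>2 * w - q\<close> points, possible since this is
    at most \<open>w\<close>. Equal choices for two functions guarantee that much overlap off
    \<open>Y\<close>.\<close>
  define R where "R c = (SOME T. T \<subseteq> supp c - Y \<and> card T = 2 * w - q)" for c :: "'f \<Rightarrow> 'f"
  have R: "R c \<subseteq> supp c - Y" "card (R c) = 2 * w - q" if "c \<in> S" for c
  proof -
    have "2 * w - q \<le> card (supp c - Y)" using wt[OF that] w by simp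
    then have "\<exists>T. T \<subseteq> supp c - Y \<and> card T = 2 * w - q"
      by (meson obtain_subset_with_card_n)
    from someI_ex[OF this] show "R c \<subseteq> supp c - Y" "card (R c) = 2 * w - q"
      by (simp_all add: R_def)
  qed
  define \<Phi> where "\<Phi> c = ((\<lambda>x. if x \<in> Y then c x else 0), R c)" for c :: "'f \<Rightarrow> 'f"
  have "inj_on \<Phi> S"
  proof (rule inj_onI)
    fix c c' assume c: "c \<in> S" "c' \<in> S" and eq: "\<Phi> c = \<Phi> c'"
    let ?e = "\<lambda>x. c x - c' x"
    have on_Y: "c x = c' x" if "x \<in> Y" for x
      using eq that by (auto simp: \<Phi>_def dest: fun_cong[of _ _ x])
    have "card (R c) \<le> card ((supp c - Y) \<inter> (supp c' - Y))"
      using R(1)[OF c(1)] R(1)[OF c(2)] eq by (intro card_mono) (auto simp: \<Phi>_def)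
    moreover have "card ((supp c - Y) \<union> (supp c' - Y)) + card ((supp c - Y) \<inter> (supp c' - Y)) = w + w"
      using card_Un_Int[of "supp c - Y" "supp c' - Y"] wt[OF c(1)] wt[OF c(2)] by simp
    ultimately have "card ((supp c - Y) \<union> (supp c' - Y)) \<le> q"
      using R(2)[OF c(1)] by linarith
    moreover have "supp ?e \<union> Y \<subseteq> ((supp c - Y) \<union> (supp c' - Y)) \<union> Y"
      using supp_diff[of c c'] by auto
    then have "card (supp ?e \<union> Y) \<le> card ((supp c - Y) \<union> (supp c' - Y)) + card Y"
      by (meson card_Un_le card_mono finite order.trans)
    \<comment> \<open>At most \<open>q\<close> points off \<open>Y\<close> and \<open>q + 1\<close>
      points in \<open>Y\<close> make \<open>2 * q + 1 \<le> d + 1\<close>, the threshold for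
      interpolation.\<close>
    ultimately have "card (supp ?e \<union> Y) \<le> d + 1"
      using Y d by linarith
    then have "supp ?e \<subseteq> Y"
      using annihilates_supp S[OF c] by blast
    then have "c x = c' x" if "x \<notin> Y" for x
      using that by (auto simp: supp_def)
    then show "c = c'" using on_Y by blast
  qed
  moreover have "\<Phi> ` S \<subseteq> G \<times> {T. card T = 2 * w - q}"
  proof (rule image_subsetI)
    fix c assume c: "c \<in> S"
    have "supp (\<lambda>x. if x \<in> Y then c x else 0) = supp c \<inter> Y"
      by (auto simp: supp_def)
    moreover have "card (supp c) = card (supp c - Y) + card (supp c \<inter> Y)"
      by (metis card_Diff_subset_Int card_Int_Diff finite add.commute)
    then have "card (supp c \<inter> Y) \<le> q - w" using wt[OF c] by linarith
    ultimately show "\<Phi> c \<in> G \<times> {T. card T = 2 * w - q}"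
      using R(2)[OF c] by (simp add: \<Phi>_def G_def)
  qed
  ultimately have "card S \<le> card (G \<times> {T :: 'f set. card T = 2 * w - q})"
    by (rule card_inj_on_le) simp
  also have "\<dots> = card G * (CARD('f) choose (2 * w - q))"
    using n_subsets[of "UNIV :: 'f set" "2 * w - q"] by (simp add: card_cartesian_product)
  also have "\<dots> \<le> ((q + 1) choose (q - w)) * CARD('f) ^ (q - w) * CARD('f) ^ (2 * w - q)"
  proof (intro mult_mono)
    show "card G \<le> ((q + 1) choose (q - w)) * CARD('f) ^ (q - w)"
      using card_supp_subset_weight[of "q - w" Y] Y by (simp add: G_def)
    show "(CARD('f) choose (2 * w - q)) \<le> CARD('f) ^ (2 * w - q)"
      by (cases "2 * w - q \<le> CARD('f)") (auto intro: binomial_le_pow simp: binomial_eq_0)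
  qed auto
  finally show ?thesis .
qed

text \<open>Each of the cases \<open>q \<le> 2 * w\<close> and \<open>2 * w < q\<close> produces one
  of the two inverse factorials. Keeping both gives a bound uniform in \<open>w\<close> whose sum
  consists of two partial exponential series.\<close>

lemma choose_power_bound:
  assumes "q + 1 \<le> N" "w \<le> q"
  shows "real (((q + 1) choose (q - w)) * N ^ (q - w) * N ^ (2 * w - q))
    \<le> real (q + 1) * real N ^ q * (1 / fact (q - w) + 1 / fact w)"
proof (cases "q \<le> 2 * w")
  case True
  have "((q + 1) choose (q - w)) * fact (q - w) \<le> (q + 1) ^ (q - w)"
    by (rule binomial_fact_pow)
  also have "\<dots> \<le> N ^ (q - w)" using assms by (intro power_mono) auto
  finally have "real (((q + 1) choose (q - w)) * fact (q - w)) \<le> real (N ^ (q - w))"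
    by (simp only: of_nat_le_iff)
  then have "real ((q + 1) choose (q - w)) \<le> real N ^ (q - w) / fact (q - w)"
    by (simp add: field_simps)
  then have "real ((q + 1) choose (q - w)) * real N ^ w \<le> real N ^ (q - w) / fact (q - w) * real N ^ w"
    by (rule mult_right_mono) simp
  also have "\<dots> = real N ^ q * (1 / fact (q - w))"
    using assms by (simp flip: power_add)
  also have "\<dots> \<le> real N ^ q * (real (q + 1) * (1 / fact (q - w) + 1 / fact w))"
  proof (rule mult_left_mono)
    have "1 / fact (q - w) + 0 \<le> 1 / fact (q - w) + (1 / fact w :: real)"
      by (intro add_left_mono) simp
    also have "\<dots> = 1 * (1 / fact (q - w) + (1 / fact w :: real))" by simp
    also have "\<dots> \<le> real (q + 1) * (1 / fact (q - w) + 1 / fact w)"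
      by (intro mult_right_mono) auto
    finally show "1 / fact (q - w) \<le> real (q + 1) * (1 / fact (q - w) + 1 / fact w)" by simp
  qed simp
  finally have "real ((q + 1) choose (q - w)) * real N ^ w
      \<le> real N ^ q * (real (q + 1) * (1 / fact (q - w) + 1 / fact w))" .
  moreover have "N ^ (q - w) * N ^ (2 * w - q) = N ^ w"
    using True assms by (simp flip: power_add)
  ultimately show ?thesis
    by (simp only: mult.assoc of_nat_mult of_nat_power) (simp only: mult_ac)
next
  case False
  \<comment> \<open>The complementary binomial coefficient is the better one here. Its index
    \<open>w + 1\<close> leaves one factor \<open>q + 1\<close> over after \<open>w\<close> factors
    are replaced by \<open>N\<close>.\<close>
  have "((q + 1) choose (w + 1)) * fact (w + 1) \<le> (q + 1) ^ (w + 1)"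
    by (rule binomial_fact_pow)
  also have "\<dots> = (q + 1) * (q + 1) ^ w" by simp
  also have "\<dots> \<le> (q + 1) * N ^ w" using assms by (intro mult_left_mono power_mono) auto
  finally have "((q + 1) choose (w + 1)) * fact (w + 1) \<le> (q + 1) * N ^ w" .
  moreover have "((q + 1) choose (w + 1)) * fact w \<le> ((q + 1) choose (w + 1)) * fact (w + 1)"
    by (intro mult_left_mono fact_mono_nat) auto
  ultimately have "real (((q + 1) choose (w + 1)) * fact w) \<le> real ((q + 1) * N ^ w)"
    by (simp only: of_nat_le_iff)
  then have "real ((q + 1) choose (w + 1)) \<le> real (q + 1) * real N ^ w / fact w"
    by (simp add: field_simps)
  then have "real ((q + 1) choose (w + 1)) * real N ^ (q - w)
      \<le> real (q + 1) * real N ^ w / fact w * real N ^ (q - w)"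
    by (rule mult_right_mono) simp
  also have "\<dots> = real (q + 1) * (real N ^ w * real N ^ (q - w)) * (1 / fact w)"
    by simp
  also have "\<dots> = real (q + 1) * real N ^ q * (1 / fact w)"
    using assms by (simp flip: power_add)
  also have "\<dots> \<le> real (q + 1) * real N ^ q * (1 / fact (q - w) + 1 / fact w)"
    by (intro mult_left_mono) auto
  finally have "real ((q + 1) choose (w + 1)) * real N ^ (q - w)
      \<le> real (q + 1) * real N ^ q * (1 / fact (q - w) + 1 / fact w)" .
  moreover have "((q + 1) choose (q - w)) = ((q + 1) choose (w + 1))"
    using assms binomial_symmetric[of "w + 1" "q + 1"] by simp
  ultimately show ?thesis using False by simp
qed

lemma sum_inverse_fact_le: "(\<Sum>w\<le>q. 1 / fact w :: real) \<le> exp 1"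
proof -
  have "(\<Sum>w\<le>q. inverse (fact w) * 1 ^ w :: real) \<le> (\<Sum>w. inverse (fact w) * 1 ^ w)"
    by (rule sum_le_suminf[OF summable_exp]) auto
  then show ?thesis by (simp add: exp_def field_simps)
qed

text \<open>The class is split by the number \<open>w\<close> of support points off
  \<open>Y\<close>. Each of the two inverse factorial sums over \<open>w\<close> is at most
  \<open>exp 1\<close>.\<close>

lemma card_annihilating_class:
  fixes Y :: "'f::{field,finite} set"
  assumes Y: "card Y = q + 1" and d: "2 * q \<le> d"
  shows "real (card {c \<in> weight_le q. annihilates d Y (\<lambda>x. c x - c\<^sub>0 x)})
    \<le> real (q + 1) * real CARD('f) ^ q * (2 * exp 1)"
proof -
  define S where "S w = {c \<in> weight_le q. annihilates d Y (\<lambda>x. c x - c\<^sub>0 x) \<and> card (supp c - Y) = w}"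
    for w
  have N: "q + 1 \<le> CARD('f)" using Y card_mono[of UNIV Y] by simp
  have S_le: "card (S w) \<le> ((q + 1) choose (q - w)) * CARD('f) ^ (q - w) * CARD('f) ^ (2 * w - q)"
    if "w \<le> q" for w
  proof (rule card_annihilating_class_weight[OF Y d that])
    fix c c' assume "c \<in> S w" "c' \<in> S w"
    then have "annihilates d Y (\<lambda>x. c x - c\<^sub>0 x)" "annihilates d Y (\<lambda>x. c' x - c\<^sub>0 x)"
      by (simp_all add: S_def)
    from annihilates_diff[OF this] show "annihilates d Y (\<lambda>x. c x - c' x)" by simp
  qed (auto simp: S_def weight_le_def)
  have "card (supp c - Y) \<le> q" if "c \<in> weight_le q" for c
    using that card_mono[of "supp c" "supp c - Y"] by (auto simp: weight_le_def)
  then have "{c \<in> weight_le q. annihilates d Y (\<lambda>x. c x - c\<^sub>0 x)} \<subseteq> (\<Union>w\<in>{..q}. S w)"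
    by (auto simp: S_def)
  then have "card {c \<in> weight_le q. annihilates d Y (\<lambda>x. c x - c\<^sub>0 x)} \<le> card (\<Union>w\<in>{..q}. S w)"
    by (intro card_mono) auto
  also have "\<dots> \<le> (\<Sum>w\<le>q. card (S w))"
    by (rule card_UN_le) simp
  finally have "card {c \<in> weight_le q. annihilates d Y (\<lambda>x. c x - c\<^sub>0 x)} \<le> (\<Sum>w\<le>q. card (S w))" .
  then have "real (card {c \<in> weight_le q. annihilates d Y (\<lambda>x. c x - c\<^sub>0 x)})
      \<le> (\<Sum>w\<le>q. real (card (S w)))"
    by (simp flip: of_nat_sum)
  also have "\<dots> \<le> (\<Sum>w\<le>q. real (q + 1) * real CARD('f) ^ q * (1 / fact (q - w) + 1 / fact w))"
  proof (rule sum_mono)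
    fix w assume "w \<in> {..q}"
    then have w: "w \<le> q" by simp
    show "real (card (S w)) \<le> real (q + 1) * real CARD('f) ^ q * (1 / fact (q - w) + 1 / fact w)"
      using choose_power_bound[OF N w] S_le[OF w] by (meson of_nat_mono order.trans)
  qed
  also have "\<dots> = real (q + 1) * real CARD('f) ^ q * ((\<Sum>w\<le>q. 1 / fact (q - w)) + (\<Sum>w\<le>q. 1 / fact w))"
    unfolding sum.distrib[symmetric] by (rule sum_distrib_left[symmetric])
  also have "(\<Sum>w\<le>q. 1 / fact (q - w)) = (\<Sum>w\<le>q. 1 / fact w :: real)"
    by (rule sum.reindex_bij_witness[of _ "\<lambda>w. q - w" "\<lambda>w. q - w"]) auto
  also have "real (q + 1) * real CARD('f) ^ q * ((\<Sum>w\<le>q. 1 / fact w) + (\<Sum>w\<le>q. 1 / fact w))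
      \<le> real (q + 1) * real CARD('f) ^ q * (2 * exp 1)"
    using sum_inverse_fact_le[of q] by (intro mult_left_mono) auto
  finally show ?thesis .
qed

section \<open>Fourier expansion of the run of an algorithm\<close>

lemma cinner_sum_left: "cinner (\<Sum>c\<in>W. u c) w = (\<Sum>c\<in>W. cinner (u c) w)"
  unfolding cinner_def by (simp add: sum_distrib_right) (rule sum.swap)

lemma cinner_sum_right: "cinner u (\<Sum>c\<in>W. w c) = (\<Sum>c\<in>W. cinner u (w c))"
  unfolding cinner_def by (simp add: sum_distrib_left) (rule sum.swap)

lemma cinner_sum:
  "cinner (\<Sum>c\<in>W. u c) (\<Sum>c\<in>V. w c) = (\<Sum>c\<in>W. \<Sum>c'\<in>V. cinner (u c) (w c'))"
  by (subst cinner_sum_left) (simp add: cinner_sum_right)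

lemma cinner_scale: "cinner (s *s u) (t *s w) = cnj s * t * cinner u w"
  by (simp add: cinner_def sum_distrib_left mult_ac)

lemma cinner_diff: "cinner (u - v) w = cinner u w - cinner v w" "cinner u (v - w) = cinner u v - cinner u w"
  by (simp_all add: cinner_def algebra_simps sum_subtractf)

lemma cinner_self: "cinner v v = complex_of_real ((norm v)\<^sup>2)"
proof -
  have "(norm v)\<^sup>2 = (\<Sum>i\<in>UNIV. (norm (v $ i))\<^sup>2)"
    by (simp add: norm_vec_def L2_set_def sum_nonneg)
  then show ?thesis
    by (simp add: cinner_def complex_norm_square mult.commute del: of_real_power)
qed

lemma matrix_vector_mult_scale:
  "(M :: complex ^ 'n ^ 'm) *v (t *s u) = t *s (M *v u)"
  by (simp add: vec_eq_iff matrix_vector_mult_def sum_distrib_left mult_ac)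

lemma matrix_vector_mult_sum:
  "(M :: complex ^ 'n ^ 'm) *v (\<Sum>c\<in>W. u c) = (\<Sum>c\<in>W. M *v u c)"
  by (induction W rule: infinite_finite_induct) (simp_all add: matrix_vector_right_distrib)

lemma cinner_adjoint: "cinner (M *v u) w = cinner u (adjoint_mat M *v w)"
proof -
  have "cinner (M *v u) w = (\<Sum>i\<in>UNIV. \<Sum>j\<in>UNIV. cnj (M $ i $ j) * cnj (u $ j) * w $ i)"
    by (simp add: cinner_def matrix_vector_mult_def sum_distrib_right)
  also have "\<dots> = (\<Sum>j\<in>UNIV. \<Sum>i\<in>UNIV. cnj (M $ i $ j) * cnj (u $ j) * w $ i)"
    by (rule sum.swap)
  also have "\<dots> = cinner u (adjoint_mat M *v w)"
    by (simp add: cinner_def matrix_vector_mult_def adjoint_mat_def sum_distrib_left mult_ac)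
  finally show ?thesis .
qed

lemma cinner_commute: "cinner u w = cnj (cinner w u)"
  by (simp add: cinner_def mult.commute)

text \<open>Expand the nonnegative form at \<open>u - w\<close>; self-adjointness makes the two
  cross terms conjugate.\<close>

lemma positive_mat_cross_le:
  assumes "positive_mat M"
  shows "2 * Re (cinner u (M *v w)) \<le> Re (cinner u (M *v u)) + Re (cinner w (M *v w))"
proof -
  have "cinner w (M *v u) = cnj (cinner u (M *v w))"
    using assms cinner_adjoint[of M u w] cinner_commute[of w "M *v u"]
    by (simp add: positive_mat_def)
  then have "Re (cinner w (M *v u)) = Re (cinner u (M *v w))" by simp
  moreover have "0 \<le> Re (cinner (u - w) (M *v (u - w)))"
    using assms by (simp add: positive_mat_def)
  ultimately show ?thesis
    by (simp add: cinner_diff matrix_vector_mult_diff_distrib)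
qed

lemma unitary_mat_norm: "unitary_mat U \<Longrightarrow> norm (U *v v) = norm v"
proof -
  assume "unitary_mat U"
  then have "cinner (U *v v) (U *v v) = cinner v v"
    by (simp add: cinner_adjoint matrix_vector_mul_assoc unitary_mat_def)
  then have "complex_of_real ((norm (U *v v))\<^sup>2) = complex_of_real ((norm v)\<^sup>2)"
    by (simp only: cinner_self)
  then show ?thesis by (simp only: of_real_eq_iff power2_eq_iff_nonneg norm_ge_zero)
qed

lemma query_op_component: "(query_op A *v v) $ (x, y, z) = v $ (x, y - poly A x, z)"
proof -
  have "query_op A $ (x, y, z) $ j * v $ j = (if j = (x, y - poly A x, z) then v $ j else 0)" for j
    by (cases j) (auto simp: query_op_def algebra_simps)
  then have "(query_op A *v v) $ (x, y, z)
      = (\<Sum>j\<in>UNIV. if j = (x, y - poly A x, z) then v $ j else 0)"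
    by (simp only: matrix_vector_mult_def vec_lambda_beta)
  then show ?thesis by simp
qed

lemma query_op_norm: "norm (query_op A *v v) = norm v"
proof -
  have "(\<Sum>i\<in>UNIV. (norm ((query_op A *v v) $ i))\<^sup>2) = (\<Sum>i\<in>UNIV. (norm (v $ i))\<^sup>2)"
    by (rule sum.reindex_bij_witness[of _ "\<lambda>(x, y, z). (x, y + poly A x, z)"
          "\<lambda>(x, y, z). (x, y - poly A x, z)"])
       (auto simp: query_op_component)
  then show ?thesis by (simp add: norm_vec_def L2_set_def)
qed

lemma run_norm:
  assumes "query_algorithm q alg" "k \<le> q"
  shows "norm (run alg A k) = 1"
  using assms(2)
  by (induction k) (use assms(1) in \<open>simp_all add: query_algorithm_def unitary_mat_norm query_op_norm\<close>)

section \<open>Runs as combinations of characters, and quadratic forms summed over cosets\<close>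

context additive_character
begin

text \<open>The span of the characters with at most \<open>k\<close> evaluation points, built term
  by term so that closure properties follow by rule induction. A frequency may occur
  repeatedly.\<close>

inductive bandlimited :: "nat \<Rightarrow> ('f poly \<Rightarrow> complex) \<Rightarrow> bool" for k where
  zero: "bandlimited k (\<lambda>A. 0)"
| char: "c \<in> weight_le k \<Longrightarrow> bandlimited k \<phi> \<Longrightarrow> bandlimited k (\<lambda>A. t * \<xi> (pairing c A) + \<phi> A)"

lemma bandlimited_add:
  assumes "bandlimited k \<phi>" "bandlimited k \<psi>"
  shows "bandlimited k (\<lambda>A. \<phi> A + \<psi> A)"
  using assms
proof (induction rule: bandlimited.induct)
  case (char c \<phi> t)
  then show ?case
    using bandlimited.char[of c k "\<lambda>A. \<phi> A + \<psi> A" t] by (simp add: add.assoc)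
qed simp

lemma bandlimited_mult:
  assumes "bandlimited k \<phi>"
  shows "bandlimited k (\<lambda>A. s * \<phi> A)"
  using assms
proof (induction rule: bandlimited.induct)
  case (char c \<phi> t)
  then show ?case
    using bandlimited.char[of c k "\<lambda>A. s * \<phi> A" "s * t"] by (simp add: algebra_simps)
qed (simp add: bandlimited.zero)

lemma bandlimited_sum:
  assumes "\<And>i. i \<in> I \<Longrightarrow> bandlimited k (\<phi> i)"
  shows "bandlimited k (\<lambda>A. \<Sum>i\<in>I. \<phi> i A)"
  using assms
  by (induction I rule: infinite_finite_induct) (auto intro: bandlimited_add bandlimited.zero)

lemma bandlimited_const: "bandlimited k (\<lambda>A. t)"
  using bandlimited.char[OF _ bandlimited.zero, of "\<lambda>x. 0" k t]
  by (simp add: weight_le_def supp_def pairing_def char_zero)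

text \<open>The extra character adds \<open>s\<close> to the coefficient at the single point
  \<open>x\<close>, so the support grows by at most one point. This is the cost of one
  query.\<close>

lemma bandlimited_mult_char:
  assumes "bandlimited k \<phi>"
  shows "bandlimited (Suc k) (\<lambda>A. \<xi> (s * poly A x) * \<phi> A)"
  using assms
proof (induction rule: bandlimited.induct)
  case (char c \<phi> t)
  define e where "e = (\<lambda>x'. if x' = x then s else 0)"
  have "supp (\<lambda>x. c x + e x) \<subseteq> insert x (supp c)" by (auto simp: supp_def e_def)
  then have "card (supp (\<lambda>x. c x + e x)) \<le> Suc k"
    using char.hyps(1) card_mono[of "insert x (supp c)" "supp (\<lambda>x. c x + e x)"]
      card_insert_le_m1[of "Suc k" "supp c" x]
    by (simp add: weight_le_def)
  moreover have "pairing e A = s * poly A x" for A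
  proof -
    have "pairing e A = (\<Sum>x'\<in>UNIV. if x' = x then s * poly A x else 0)"
      unfolding pairing_def by (intro sum.cong) (auto simp: e_def)
    then show ?thesis by simp
  qed
  ultimately show ?case
    using bandlimited.char[of "\<lambda>x. c x + e x" "Suc k" _ t, OF _ char.IH]
    by (simp add: weight_le_def pairing_add_left char_add algebra_simps)
qed (simp add: bandlimited.zero)

text \<open>Repeated frequencies are collected into one coefficient each, independent of
  \<open>A\<close>.\<close>

lemma bandlimited_expansion:
  assumes "bandlimited k \<phi>"
  shows "\<exists>a. \<forall>A. \<phi> A = (\<Sum>c\<in>weight_le k. a c * \<xi> (pairing c A))"
  using assms
proof (induction rule: bandlimited.induct)
  case zero
  show ?case by (intro exI[of _ "\<lambda>_. 0"]) simp
next
  case (char c \<phi> t)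
  then obtain a where a: "\<And>A. \<phi> A = (\<Sum>c\<in>weight_le k. a c * \<xi> (pairing c A))" by blast
  have "t * \<xi> (pairing c A) = (\<Sum>c'\<in>weight_le k. (if c' = c then t else 0) * \<xi> (pairing c' A))" for A
    using char.hyps(1) by (simp add: if_distrib[of "\<lambda>u. u * _"] sum.delta cong: if_cong)
  then have expansion: "t * \<xi> (pairing c A) + \<phi> A
      = (\<Sum>c'\<in>weight_le k. ((if c' = c then t else 0) + a c') * \<xi> (pairing c' A))" for A
    by (simp only: a ring_distribs sum.distrib)
  show ?case
    by (rule exI[of _ "\<lambda>c'. (if c' = c then t else 0) + a c'"], rule allI, rule expansion)
qed

text \<open>
  A query turns the amplitude at response \<open>y\<close> into a sum over all responses \<open>u\<close> of the old
  amplitude times the indicator of \<open>poly A x = y - u\<close>, which is an average of characters.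
\<close>

lemma run_bandlimited: "bandlimited k (\<lambda>A. run alg A k $ i)"
proof (induction k arbitrary: i)
  case 0
  show ?case by (simp add: bandlimited_const)
next
  case (Suc k)
  have query: "bandlimited (Suc k) (\<lambda>A. (query_op A *v run alg A k) $ j)" for j
  proof -
    obtain x y z where j: "j = (x, y, z)" by (cases j)
    have "(query_op A *v run alg A k) $ j = (\<Sum>u\<in>UNIV. \<Sum>s\<in>UNIV.
        (\<xi> (- (s * (y - u))) / of_nat CARD('f)) * (\<xi> (s * poly A x) * run alg A k $ (x, u, z)))" for A
    proof -
      have "(\<Sum>s\<in>UNIV. (\<xi> (- (s * (y - u))) / of_nat CARD('f)) * (\<xi> (s * poly A x) * w))
          = (if u = y - poly A x then w else 0)" for u w
      proof -
        have "(\<xi> (- (s * (y - u))) / of_nat CARD('f)) * (\<xi> (s * poly A x) * w)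
            = \<xi> (s * (poly A x - (y - u))) / of_nat CARD('f) * w" for s
          using char_add[of "- (s * (y - u))" "s * poly A x"] by (simp add: algebra_simps)
        then have "(\<Sum>s\<in>UNIV. (\<xi> (- (s * (y - u))) / of_nat CARD('f)) * (\<xi> (s * poly A x) * w))
            = (\<Sum>s\<in>UNIV. \<xi> (s * (poly A x - (y - u)))) / of_nat CARD('f) * w"
          by (simp only: sum_divide_distrib sum_distrib_right)
        also have "\<dots> = (if u = y - poly A x then w else 0)"
          unfolding sum_char_mult by (auto simp: algebra_simps)
        finally show ?thesis .
      qed
      then show ?thesis by (simp add: j query_op_component)
    qed
    then show ?thesis
      by (simp only:) (intro bandlimited_sum bandlimited_mult bandlimited_mult_char Suc.IH)
  qed
  \<comment> \<open>The gate does not depend on \<open>A\<close>, so it only forms fixed linear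
    combinations and leaves the weight unchanged.\<close>
  show ?case
    by (simp add: matrix_vector_mult_def[of "gate alg k"] bandlimited_sum bandlimited_mult query)
qed

lemma run_expansion:
  "\<exists>a. \<forall>A. run alg A k = (\<Sum>c\<in>weight_le k. \<xi> (pairing c A) *s a c)"
proof -
  have "\<forall>i. \<exists>a. \<forall>A. run alg A k $ i = (\<Sum>c\<in>weight_le k. a c * \<xi> (pairing c A))"
    using bandlimited_expansion[OF run_bandlimited] by blast
  then obtain a where a: "\<And>i A. run alg A k $ i = (\<Sum>c\<in>weight_le k. a i c * \<xi> (pairing c A))"
    by metis
  have expansion: "run alg A k = (\<Sum>c\<in>weight_le k. \<xi> (pairing c A) *s (\<chi> i. a i c))" for A
    by (simp add: vec_eq_iff a mult.commute)
  show ?thesis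
    by (rule exI[of _ "\<lambda>c. \<chi> i. a i c"], rule allI, rule expansion)
qed

text \<open>The pair \<open>c\<close>, \<open>c'\<close> carries the character of
  \<open>c' - c\<close>, whose sum over the coset vanishes unless that difference annihilates the
  subgroup. The surviving phases at \<open>A\<^sub>0\<close> are absorbed into
  \<open>b\<close>.\<close>

lemma sum_fibre_form:
  fixes M :: "complex ^ 'n ^ 'n" and a :: "('f \<Rightarrow> 'f) \<Rightarrow> complex ^ 'n"
  assumes A0: "A\<^sub>0 \<in> polys_upto d"
    and \<psi>: "\<And>A. \<psi> A = (\<Sum>c\<in>W. \<xi> (pairing c A) *s a c)"
    and b: "\<And>c. b c = \<xi> (pairing c A\<^sub>0) *s a c"
  shows "(\<Sum>A | A \<in> polys_upto d \<and> (\<forall>y\<in>Y. poly A y = poly A\<^sub>0 y). cinner (\<psi> A) (M *v \<psi> A))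
    = of_nat (card (vanishing_polys d Y)) * (\<Sum>c\<in>W. \<Sum>c'\<in>W.
        if annihilates d Y (\<lambda>x. c' x - c x) then cinner (b c) (M *v b c') else 0)"
proof -
  let ?\<Gamma> = "{A. A \<in> polys_upto d \<and> (\<forall>y\<in>Y. poly A y = poly A\<^sub>0 y)}"
  have "cinner (\<psi> A) (M *v \<psi> A)
      = (\<Sum>c\<in>W. \<Sum>c'\<in>W. \<xi> (pairing (\<lambda>x. c' x - c x) A) * cinner (a c) (M *v a c'))" for A
    by (simp add: \<psi> matrix_vector_mult_sum matrix_vector_mult_scale cinner_sum
        cinner_scale pairing_diff_left char_diff mult_ac)
  then have "(\<Sum>A\<in>?\<Gamma>. cinner (\<psi> A) (M *v \<psi> A))
      = (\<Sum>A\<in>?\<Gamma>. \<Sum>c\<in>W. \<Sum>c'\<in>W. \<xi> (pairing (\<lambda>x. c' x - c x) A) * cinner (a c) (M *v a c'))"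
    by simp
  also have "\<dots> = (\<Sum>c\<in>W. \<Sum>A\<in>?\<Gamma>. \<Sum>c'\<in>W. \<xi> (pairing (\<lambda>x. c' x - c x) A) * cinner (a c) (M *v a c'))"
    by (rule sum.swap)
  also have "\<dots> = (\<Sum>c\<in>W. \<Sum>c'\<in>W. \<Sum>A\<in>?\<Gamma>. \<xi> (pairing (\<lambda>x. c' x - c x) A) * cinner (a c) (M *v a c'))"
    by (rule sum.cong[OF refl], rule sum.swap)
  also have "\<dots> = (\<Sum>c\<in>W. \<Sum>c'\<in>W. (\<Sum>A\<in>?\<Gamma>. \<xi> (pairing (\<lambda>x. c' x - c x) A)) * cinner (a c) (M *v a c'))"
    by (simp only: sum_distrib_right)
  also have "\<dots> = (\<Sum>c\<in>W. \<Sum>c'\<in>W. of_nat (card (vanishing_polys d Y)) *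
        (if annihilates d Y (\<lambda>x. c' x - c x) then cinner (b c) (M *v b c') else 0))"
    by (intro sum.cong refl, subst sum_char_fibre[OF A0])
       (simp add: b matrix_vector_mult_scale cinner_scale pairing_diff_left char_diff mult_ac)
  finally show ?thesis by (simp only: sum_distrib_left)
qed

text \<open>Parseval's identity, from the coset formula with empty \<open>Y\<close>: differences
  have support at most \<open>2 * q \<le> d\<close>, so only equal frequencies interact.\<close>

lemma sum_all_form:
  fixes M :: "complex ^ 'n ^ 'n" and a :: "('f \<Rightarrow> 'f) \<Rightarrow> complex ^ 'n"
  assumes d: "2 * q \<le> d"
    and \<psi>: "\<And>A. \<psi> A = (\<Sum>c\<in>weight_le q. \<xi> (pairing c A) *s a c)"
  shows "(\<Sum>A\<in>polys_upto d. cinner (\<psi> A) (M *v \<psi> A))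
    = of_nat (card (polys_upto d :: 'f poly set)) * (\<Sum>c\<in>weight_le q. cinner (a c) (M *v a c))"
proof -
  have eq: "annihilates d {} (\<lambda>x. c' x - c x) \<longleftrightarrow> c = c'" if "c \<in> weight_le q" "c' \<in> weight_le q" for c c'
  proof
    assume ann: "annihilates d {} (\<lambda>x. c' x - c x)"
    have "card (supp (\<lambda>x. c' x - c x)) \<le> card (supp c') + card (supp c)"
      by (rule order.trans[OF card_mono[OF _ supp_diff] card_Un_le]) simp
    then have "supp (\<lambda>x. c' x - c x) \<subseteq> {}"
      using that d by (intro annihilates_supp[OF ann]) (simp add: weight_le_def)
    then show "c = c'" by (auto simp: supp_def)
  qed (simp add: annihilates_def pairing_def)
  have zero: "0 \<in> polys_upto d" by (simp add: polys_upto_def)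
  have b: "a c = \<xi> (pairing c 0) *s a c" for c by (simp add: pairing_def char_zero)
  have "(\<Sum>A | A \<in> polys_upto d \<and> (\<forall>y\<in>{}. poly A y = poly 0 y). cinner (\<psi> A) (M *v \<psi> A))
    = of_nat (card (vanishing_polys d ({} :: 'f set))) * (\<Sum>c\<in>weight_le q. \<Sum>c'\<in>weight_le q.
        if annihilates d {} (\<lambda>x. c' x - c x) then cinner (a c) (M *v a c') else 0)"
    by (rule sum_fibre_form[OF zero \<psi> b])
  then
  have "(\<Sum>A\<in>polys_upto d. cinner (\<psi> A) (M *v \<psi> A))
    = of_nat (card (polys_upto d :: 'f poly set)) * (\<Sum>c\<in>weight_le q. \<Sum>c'\<in>weight_le q.
        if annihilates d {} (\<lambda>x. c' x - c x) then cinner (a c) (M *v a c') else 0)"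
    by (simp add: vanishing_polys_empty)
  also have "(\<Sum>c\<in>weight_le q. \<Sum>c'\<in>weight_le q.
        if annihilates d {} (\<lambda>x. c' x - c x) then cinner (a c) (M *v a c') else 0)
      = (\<Sum>c\<in>weight_le q. \<Sum>c'\<in>weight_le q. if c = c' then cinner (a c) (M *v a c') else 0)"
    by (intro sum.cong refl) (simp add: eq)
  also have "\<dots> = (\<Sum>c\<in>weight_le q. cinner (a c) (M *v a c))"
    by (simp add: sum.delta)
  finally show ?thesis .
qed

text \<open>Every cross term is at most half the sum of its two diagonal terms. The relation is
  symmetric and each \<open>c\<close> is related to at most \<open>K\<close> others, itself counted,
  so each diagonal term is used at most \<open>K\<close> times in total.\<close>

lemma sum_fibre_le:
  fixes M :: "complex ^ 'n ^ 'n" and a :: "('f \<Rightarrow> 'f) \<Rightarrow> complex ^ 'n"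
  assumes M: "positive_mat M"
    and A0: "A\<^sub>0 \<in> polys_upto d"
    and \<psi>: "\<And>A. \<psi> A = (\<Sum>c\<in>W. \<xi> (pairing c A) *s a c)"
    and K: "\<And>c. real (card {c' \<in> W. annihilates d Y (\<lambda>x. c' x - c x)}) \<le> K"
  shows "(\<Sum>A | A \<in> polys_upto d \<and> (\<forall>y\<in>Y. poly A y = poly A\<^sub>0 y). Re (cinner (\<psi> A) (M *v \<psi> A)))
    \<le> real (card (vanishing_polys d Y)) * (K * (\<Sum>c\<in>W. Re (cinner (a c) (M *v a c))))"
proof -
  let ?Q = "\<lambda>c. Re (cinner (a c) (M *v a c))"
  let ?rel = "\<lambda>c c'. annihilates d Y (\<lambda>x. c' x - c x)"
  define b where "b = (\<lambda>c. \<xi> (pairing c A\<^sub>0) *s a c)"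
  \<comment> \<open>The phase has modulus one and cancels in the quadratic form.\<close>
  have Qb: "Re (cinner (b c) (M *v b c)) = ?Q c" for c
    using norm_char[of "pairing c A\<^sub>0"] complex_norm_square[of "\<xi> (pairing c A\<^sub>0)"]
    by (simp add: b_def matrix_vector_mult_scale cinner_scale mult.commute)
  have Q_nonneg: "0 \<le> ?Q c" for c using M by (simp add: positive_mat_def)
  have diag: "(\<Sum>c\<in>W. \<Sum>c'\<in>W. if ?rel c c' then ?Q c else 0) \<le> K * (\<Sum>c\<in>W. ?Q c)"
  proof -
    have "(\<Sum>c'\<in>W. if ?rel c c' then ?Q c else 0) \<le> K * ?Q c" for c
    proof -
      have "(\<Sum>c'\<in>W. if ?rel c c' then ?Q c else 0) = (\<Sum>c'\<in>{c' \<in> W. ?rel c c'}. ?Q c)"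
        by (rule sum.inter_filter[symmetric]) simp
      also have "\<dots> \<le> K * ?Q c" using mult_right_mono[OF K Q_nonneg] by simp
      finally show ?thesis .
    qed
    then show ?thesis by (simp add: sum_distrib_left sum_mono)
  qed
  have "(\<Sum>c\<in>W. \<Sum>c'\<in>W. if ?rel c c' then ?Q c' else 0)
      = (\<Sum>c'\<in>W. \<Sum>c\<in>W. if ?rel c c' then ?Q c' else 0)"
    by (rule sum.swap)
  also have "\<dots> = (\<Sum>c\<in>W. \<Sum>c'\<in>W. if ?rel c c' then ?Q c else 0)"
    by (intro sum.cong refl if_cong annihilates_commute)
  finally have off_diag: "(\<Sum>c\<in>W. \<Sum>c'\<in>W. if ?rel c c' then ?Q c' else 0)
      = (\<Sum>c\<in>W. \<Sum>c'\<in>W. if ?rel c c' then ?Q c else 0)" .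
  have "2 * (\<Sum>c\<in>W. \<Sum>c'\<in>W. if ?rel c c' then Re (cinner (b c) (M *v b c')) else 0)
      = (\<Sum>c\<in>W. \<Sum>c'\<in>W. 2 * (if ?rel c c' then Re (cinner (b c) (M *v b c')) else 0))"
    by (simp only: sum_distrib_left)
  also have "\<dots> \<le> (\<Sum>c\<in>W. \<Sum>c'\<in>W. (if ?rel c c' then ?Q c else 0) + (if ?rel c c' then ?Q c' else 0))"
    using positive_mat_cross_le[OF M] by (intro sum_mono) (simp flip: Qb)
  also have "\<dots> \<le> 2 * (K * (\<Sum>c\<in>W. ?Q c))"
    using diag by (simp add: sum.distrib off_diag)
  finally have "(\<Sum>c\<in>W. \<Sum>c'\<in>W. if ?rel c c' then Re (cinner (b c) (M *v b c')) else 0)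
      \<le> K * (\<Sum>c\<in>W. ?Q c)" by simp
  moreover have "Re (\<Sum>A | A \<in> polys_upto d \<and> (\<forall>y\<in>Y. poly A y = poly A\<^sub>0 y). cinner (\<psi> A) (M *v \<psi> A))
      = real (card (vanishing_polys d Y))
        * (\<Sum>c\<in>W. \<Sum>c'\<in>W. if ?rel c c' then Re (cinner (b c) (M *v b c')) else 0)"
    by (subst sum_fibre_form[OF A0 \<psi>, of b])
       (simp_all add: b_def if_distrib[of Re] cong: if_cong)
  ultimately show ?thesis by (simp add: mult_left_mono)
qed

end

section \<open>The success probability\<close>

text \<open>The averaged output distribution has total mass one, and for each output the correct
  polynomials contribute at most \<open>K / N ^ (q + 1)\<close> times its mass. The powers of
  \<open>N\<close> cancel up to a single factor.\<close>

lemma (in additive_character) success_prob_le: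
  fixes alg :: "('f::{field,finite}, 'z::finite) qalg"
  assumes d: "2 * q \<le> d" and alg: "query_algorithm q alg"
  shows "success_prob d q alg \<le> real (q + 1) * (2 * exp 1) / real CARD('f)"
proof -
  define P where "P = (polys_upto d :: 'f poly set)"
  define N where "N = CARD('f)"
  define K where "K = real (q + 1) * real N ^ q * (2 * exp 1)"
  obtain a where a: "\<And>A. run alg A q = (\<Sum>c\<in>weight_le q. \<xi> (pairing c A) *s a c)"
    using run_expansion by blast
  \<comment> \<open>By \<open>sum_all_form\<close>, for \<open>M = meas alg out\<close> this is the
    probability of \<open>out\<close> averaged over all polynomials.\<close>
  define Q where "Q M = (\<Sum>c\<in>weight_le q. Re (cinner (a c) (M *v a c)))" for M
  define Outs where "Outs = {out :: ('f \<times> 'f) list. length out = q + 1}"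
  have fin: "finite Outs"
    using finite_lists_length_eq[of "UNIV :: ('f \<times> 'f) set" "q + 1"] by (simp add: Outs_def)
  have finP: "finite P" by (simp add: P_def finite_polys_upto)
  have "0 \<in> P" by (simp add: P_def polys_upto_def)
  then have P_pos: "real (card P) > 0" using finP by (auto simp: card_gt_0_iff)
  have N_pos: "real N > 0" by (simp add: N_def)
  have pos: "positive_mat (meas alg out)" if "out \<in> Outs" for out
    using alg that by (simp add: query_algorithm_def Outs_def)
  have Q_nonneg: "0 \<le> Q (meas alg out)" if "out \<in> Outs" for out
    using pos[OF that] by (auto simp: Q_def positive_mat_def intro: sum_nonneg)
  \<comment> \<open>Parseval for the identity matrix: unit norm of every final state yields
    \<open>Q (mat 1) = 1\<close>.\<close>
  have "complex_of_real (real (card P)) = (\<Sum>A\<in>P. cinner (run alg A q) (mat 1 *v run alg A q))"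
    using run_norm[OF alg order.refl] by (simp add: cinner_self)
  also have "\<dots> = of_nat (card P) * (\<Sum>c\<in>weight_le q. cinner (a c) (mat 1 *v a c))"
    unfolding P_def by (rule sum_all_form[OF d a])
  finally have "complex_of_real (real (card P))
      = of_nat (card P) * (\<Sum>c\<in>weight_le q. cinner (a c) (mat 1 *v a c))" .
  then have "(\<Sum>c\<in>weight_le q. cinner (a c) (mat 1 *v a c)) = 1"
    using P_pos by simp
  then have "Q (mat 1) = 1"
    by (simp add: Q_def flip: Re_sum)
  moreover have "(\<Sum>out\<in>Outs. Q (meas alg out)) = Q (\<Sum>out\<in>Outs. meas alg out)"
  proof -
    have "(\<Sum>out\<in>Outs. meas alg out) *v v = (\<Sum>out\<in>Outs. meas alg out *v v)" for v
      by (induction Outs rule: infinite_finite_induct) (simp_all add: matrix_vector_mult_add_rdistrib)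
    then show ?thesis
      unfolding Q_def by (simp add: cinner_sum_right) (rule sum.swap)
  qed
  moreover have "(\<Sum>out\<in>Outs. meas alg out) = mat 1"
    using alg by (simp add: query_algorithm_def Outs_def)
  ultimately have total: "(\<Sum>out\<in>Outs. Q (meas alg out)) = 1" by simp

  have fibre: "(\<Sum>A | A \<in> P \<and> out \<in> correct_outputs q A. output_prob q alg A out)
      \<le> real (card P) / real N ^ (q + 1) * K * Q (meas alg out)" if out: "out \<in> Outs" for out
  proof (cases "\<exists>A\<^sub>0\<in>P. out \<in> correct_outputs q A\<^sub>0")
    case True
    then obtain A\<^sub>0 where A0: "A\<^sub>0 \<in> P" "out \<in> correct_outputs q A\<^sub>0" by blast
    define Y where "Y = fst ` set out"
    have card_Y: "card Y = q + 1"
      using A0(2) distinct_card[of "map fst out"] by (simp add: Y_def correct_outputs_def)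
    \<comment> \<open>Once one polynomial fits \<open>out\<close>, those that fit are exactly the
      ones agreeing with it on \<open>Y\<close>, a full fibre.\<close>
    have "out \<in> correct_outputs q A \<longleftrightarrow> (\<forall>y\<in>Y. poly A y = poly A\<^sub>0 y)" for A
      using A0(2) by (fastforce simp: correct_outputs_def Y_def)
    then have "(\<Sum>A | A \<in> P \<and> out \<in> correct_outputs q A. output_prob q alg A out)
        = (\<Sum>A | A \<in> polys_upto d \<and> (\<forall>y\<in>Y. poly A y = poly A\<^sub>0 y).
            Re (cinner (run alg A q) (meas alg out *v run alg A q)))"
      by (simp add: P_def output_prob_def)
    also have "\<dots> \<le> real (card (vanishing_polys d Y)) * (K * Q (meas alg out))"
      unfolding Q_def
    proof (rule sum_fibre_le[OF pos[OF out] _ a])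
      show "A\<^sub>0 \<in> polys_upto d" using A0(1) by (simp add: P_def)
      show "real (card {c' \<in> weight_le q. annihilates d Y (\<lambda>x. c' x - c x)}) \<le> K" for c
        using card_annihilating_class[OF card_Y d] by (simp add: K_def N_def)
    qed
    also have "\<dots> \<le> real (card P) / real N ^ (q + 1) * (K * Q (meas alg out))"
    proof (rule mult_right_mono)
      have "card (vanishing_polys d Y) * N ^ (q + 1) \<le> card P"
        using card_vanishing_polys[of Y d] card_Y d by (simp add: P_def N_def)
      then have "real (card (vanishing_polys d Y) * N ^ (q + 1)) \<le> real (card P)"
        by (simp only: of_nat_le_iff)
      then show "real (card (vanishing_polys d Y)) \<le> real (card P) / real N ^ (q + 1)"
        using N_pos by (simp add: field_simps)
      show "0 \<le> K * Q (meas alg out)" using Q_nonneg[OF out] by (simp add: K_def)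
    qed
    finally show ?thesis by (simp add: mult.assoc)
  next
    \<comment> \<open>Outputs with a repeated input fall here.\<close>
    case False
    then have "{A. A \<in> P \<and> out \<in> correct_outputs q A} = {}" by blast
    moreover have "0 \<le> real (card P) / real N ^ (q + 1) * K * Q (meas alg out)"
      using Q_nonneg[OF out] by (simp add: K_def)
    ultimately show ?thesis by (simp only: sum.empty)
  qed

  have "(\<Sum>A\<in>P. \<Sum>out\<in>correct_outputs q A. output_prob q alg A out)
      = (\<Sum>A\<in>P. \<Sum>out\<in>{out \<in> Outs. out \<in> correct_outputs q A}. output_prob q alg A out)"
    by (intro sum.cong refl) (auto simp: Outs_def correct_outputs_def)
  also have "\<dots> = (\<Sum>out\<in>Outs. \<Sum>A\<in>{A \<in> P. out \<in> correct_outputs q A}. output_prob q alg A out)"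
    by (rule sum.swap_restrict[OF finP fin])
  also have "\<dots> \<le> (\<Sum>out\<in>Outs. real (card P) / real N ^ (q + 1) * K * Q (meas alg out))"
    using fibre by (rule sum_mono)
  also have "\<dots> = real (card P) / real N ^ (q + 1) * K"
    unfolding sum_distrib_left[symmetric] total by simp
  finally have "success_prob d q alg \<le> real (card P) / real N ^ (q + 1) * K / real (card P)"
    unfolding success_prob_def P_def[symmetric] using P_pos by (intro divide_right_mono) auto
  also have "\<dots> = real (q + 1) * (2 * exp 1) / real N"
    using P_pos N_pos by (simp add: K_def field_simps)
  finally show ?thesis by (simp add: N_def)
qed

text \<open>The sharper constant \<open>2 * exp 1\<close> is at most
  \<open>q * exp (2 * sqrt q)\<close> once \<open>q \<ge> 1\<close>. For \<open>q = 0\<close> the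
  right-hand side would be zero, while \<open>zero_queries_success_prob_pos\<close> provides a guess
  with positive success probability.\<close>

theorem theorem7:
  fixes alg :: "('f::{field,finite}, 'z::finite) qalg"
    and d q :: nat
  assumes "1 \<le> q"
    and "real q \<le> real d / 2"
    and "query_algorithm q alg"
  shows "success_prob d q alg
           \<le> real (q + 1) * real q * exp (2 * sqrt (real q)) / real CARD('f)"
proof -
  obtain \<xi> :: "'f \<Rightarrow> complex" where "additive_character \<xi>"
    using additive_character_exists by blast
  then interpret additive_character \<xi> .
  have "2 * exp 1 \<le> exp 1 * (exp 1 :: real)"
    using exp_ge_add_one_self[of 1] by (intro mult_right_mono) auto
  also have "\<dots> = exp 2" by (simp flip: exp_add)
  also have "\<dots> \<le> 1 * exp (2 * sqrt (real q))" using assms(1) by simp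
  also have "\<dots> \<le> real q * exp (2 * sqrt (real q))"
    using assms(1) by (intro mult_right_mono) auto
  finally have "2 * exp 1 \<le> real q * exp (2 * sqrt (real q))" .
  then have "real (q + 1) * (2 * exp 1) / real CARD('f)
      \<le> real (q + 1) * (real q * exp (2 * sqrt (real q))) / real CARD('f)"
    by (intro divide_right_mono mult_left_mono) auto
  moreover have "2 * q \<le> d" using assms(2) by linarith
  ultimately show ?thesis
    using success_prob_le[of q d alg] assms(3) by (simp add: mult.assoc)
qed

end
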